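(* Let a parabola be tangent to a circle at two distinct points $A$ and $B$ in the Euclidean plane. Then an arbitrary point $P$ of the plane lies on the parabola if and only if the distance from $P$ to the line $AB$ equals the length of the tangent from $P$ to the circle.
   Context: For a circle with centre $O$ and radius $r$, the length of the tangent from a point $P$ lying outside or on the circle is $\sqrt{PO^2-r^2}$ (equal to $0$ when $P$ is on the circle). A point strictly inside the circle has no tangent to the circle, and the condition "distance equals the length of the tangent" is understood to fail for such a point. *)

theory Defs
  imports "HOL-Analysis.Analysis"
begin

definition is_line :: "(real^2) set \<Rightarrow> bool" where
  "is_line L \<longleftrightarrow> affine L \<and> aff_dim L = 1"

definition is_parabola :: "(real^2) set \<Rightarrow> bool" where
  "is_parabola K \<longleftrightarrow>
     (\<exists>F d. is_line d \<and> F \<notin> d \<and> K = {X. dist X F = infdist X d})"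

text \<open>
  The tangent line as the limit of secants: for \<open>A\<close> on \<open>L\<close> and \<open>X \<noteq> A\<close>, the quotient
  \<open>infdist X L / dist X A\<close> is the sine of the angle between the secant \<open>AX\<close> and \<open>L\<close>.
  Without \<open>A islimpt S\<close> every line through an isolated point \<open>A\<close> would be tangent.
\<close>

definition tangent_line_at :: "(real^2) set \<Rightarrow> real^2 \<Rightarrow> (real^2) set \<Rightarrow> bool" where
  "tangent_line_at S A L \<longleftrightarrow>
     is_line L \<and> A \<in> L \<and> A \<in> S \<and> A islimpt S \<and>
     ((\<lambda>X. infdist X L / dist X A) \<longlongrightarrow> 0) (at A within S)"

definition curves_tangent_at :: "(real^2) set \<Rightarrow> (real^2) set \<Rightarrow> real^2 \<Rightarrow> bool" where
  "curves_tangent_at S T A \<longleftrightarrow> (\<exists>L. tangent_line_at S A L \<and> tangent_line_at T A L)"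

text \<open>
  The following is meaningful only for \<open>r \<le> dist P c\<close>; there is no tangent from a point
  strictly inside the circle, so every use has to be guarded by that condition.
\<close>

definition tangent_length :: "real^2 \<Rightarrow> real \<Rightarrow> real^2 \<Rightarrow> real" where
  "tangent_length c r P = sqrt ((dist P c)\<^sup>2 - r\<^sup>2)"

end

theory Submission
  imports Defs
begin

text \<open>
  Let \<open>h\<close> be the signed distance from the directrix to the focus. In Cartesian coordinates with the
  directrix as first axis and the focus on the second one, the parabola is
  \<open>x\<^sup>2 = 2 h y - h\<^sup>2\<close>. At a point of tangency the gradients of the equations of the parabola and of the
  circle are both normal to the common tangent, hence parallel. This condition at \<open>A\<close> and at \<open>B\<close>,
  together with \<open>AO = BO\<close>, forces \<open>A\<close> and \<open>B\<close> to be mirror images in the axis of the parabola and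
  determines the circle. The power of \<open>P = (x, y)\<close> with respect to the circle minus the squared
  distance from \<open>P\<close> to \<open>AB\<close> then equals \<open>x\<^sup>2 - 2 h y + h\<^sup>2\<close>.
\<close>

definition cross2 :: "real^2 \<Rightarrow> real^2 \<Rightarrow> real" where
  "cross2 u v = u$1 * v$2 - u$2 * v$1"

definition rot90 :: "real^2 \<Rightarrow> real^2" where
  "rot90 n = vector [- n$2, n$1]"

lemma inner_real2: "(u::real^2) \<bullet> v = u$1 * v$1 + u$2 * v$2"
  by (simp add: inner_vec_def sum_2)

lemma rot90_nth [simp]: "rot90 n $ 1 = - n$2" "rot90 n $ 2 = n$1"
  by (simp_all add: rot90_def)

text \<open>Pythagoras in the orthonormal basis \<open>rot90 n\<close>, \<open>n\<close>.\<close>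

lemma norm_sq_rot90_coords:
  assumes "norm n = 1"
  shows "(norm z)\<^sup>2 = (rot90 n \<bullet> z)\<^sup>2 + (n \<bullet> z)\<^sup>2"
proof -
  have "n$1 * n$1 + n$2 * n$2 = 1"
    using assms by (metis inner_real2 norm_eq_1)
  moreover have "(rot90 n \<bullet> z)\<^sup>2 + (n \<bullet> z)\<^sup>2 = (n$1 * n$1 + n$2 * n$2) * (z \<bullet> z)"
    by (simp add: inner_real2 power2_eq_square algebra_simps)
  ultimately show ?thesis
    by (simp add: power2_norm_eq_inner)
qed

text \<open>The basis \<open>n\<close>, \<open>rot90 n\<close> is positively oriented with
  determinant 1, so passing to its coordinates leaves the determinant \<open>cross2\<close>
  unchanged.\<close>

lemma cross2_rot90_coords:
  assumes "norm n = 1"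
  shows "cross2 u v = (n \<bullet> u) * (rot90 n \<bullet> v) - (rot90 n \<bullet> u) * (n \<bullet> v)"
proof -
  have "n$1 * n$1 + n$2 * n$2 = 1"
    using assms by (metis inner_real2 norm_eq_1)
  moreover have "(n \<bullet> u) * (rot90 n \<bullet> v) - (rot90 n \<bullet> u) * (n \<bullet> v)
      = (n$1 * n$1 + n$2 * n$2) * cross2 u v"
    by (simp add: inner_real2 cross2_def algebra_simps)
  ultimately show ?thesis by simp
qed

text \<open>Parallelism is transitive only through a nonzero vector; \<open>w\<close> will be the
  normal of the common tangent.\<close>

lemma cross2_zero_trans:
  assumes "cross2 u w = 0" "cross2 v w = 0" "w \<noteq> 0"
  shows "cross2 u v = 0"
proof -
  have "w$1 * cross2 u v = 0" "w$2 * cross2 u v = 0"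
    using assms(1,2) unfolding cross2_def by algebra+
  then show ?thesis
    using assms(3) by (auto simp: vec_eq_iff forall_2)
qed

text \<open>The vector \<open>(u \<bullet> z) *\<^sub>R w - (w \<bullet> z) *\<^sub>R u\<close> is
  \<open>z\<close> turned by a right angle and scaled by \<open>cross2 u w\<close>, up to sign; the
  triangle inequality bounds its norm. Hence \<open>u\<close> and \<open>w\<close> are parallel as
  soon as both inner products are small compared with \<open>norm z\<close>.\<close>

lemma abs_cross2_mult_norm_le:
  "\<bar>cross2 u w\<bar> * norm z \<le> \<bar>u \<bullet> z\<bar> * norm w + \<bar>w \<bullet> z\<bar> * norm u"
proof -
  have "(\<bar>cross2 u w\<bar> * norm z)\<^sup>2 = (norm ((u \<bullet> z) *\<^sub>R w - (w \<bullet> z) *\<^sub>R u))\<^sup>2"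
    unfolding power_mult_distrib power2_norm_eq_inner
    by (simp add: inner_real2 cross2_def power2_eq_square algebra_simps)
  then have "\<bar>cross2 u w\<bar> * norm z = norm ((u \<bullet> z) *\<^sub>R w - (w \<bullet> z) *\<^sub>R u)"
    by (simp add: power2_eq_iff_nonneg)
  also have "\<dots> \<le> \<bar>u \<bullet> z\<bar> * norm w + \<bar>w \<bullet> z\<bar> * norm u"
    by (metis norm_scaleR norm_triangle_ineq4)
  finally show ?thesis .
qed

lemma is_line_unit_normal:
  assumes "is_line L"
  obtains n k where "norm n = 1" "L = {X. n \<bullet> X = k}"
proof -
  have "affine hull L = L" "aff_dim L = int (DIM(real^2) - 1)"
    using assms by (simp_all add: is_line_def affine_hull_eq)
  then obtain a b where ab: "a \<noteq> 0" "L = {x. a \<bullet> x = b}"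
    using aff_dim_eq_hyperplane[of L] by metis
  have "norm (a /\<^sub>R norm a) = 1" "L = {X. (a /\<^sub>R norm a) \<bullet> X = b / norm a}"
    using ab by (auto simp: field_simps)
  then show ?thesis by (rule that)
qed

lemma infdist_hyperplane:
  fixes n :: "'a::euclidean_space"
  assumes "norm n = 1"
  shows "infdist X {Y. n \<bullet> Y = k} = \<bar>n \<bullet> X - k\<bar>"
proof (rule antisym)
  have nn: "n \<bullet> n = 1" using assms by (simp add: norm_eq_1)
  \<comment> \<open>The foot of the perpendicular from \<open>X\<close>.\<close>
  have "X - (n \<bullet> X - k) *\<^sub>R n \<in> {Y. n \<bullet> Y = k}"
    by (simp add: inner_diff_right nn)
  then have "infdist X {Y. n \<bullet> Y = k} \<le> dist X (X - (n \<bullet> X - k) *\<^sub>R n)"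
    and ne: "{Y. n \<bullet> Y = k} \<noteq> {}"
    by (rule infdist_le, blast)
  then show "infdist X {Y. n \<bullet> Y = k} \<le> \<bar>n \<bullet> X - k\<bar>"
    by (simp add: dist_norm assms)
  show "\<bar>n \<bullet> X - k\<bar> \<le> infdist X {Y. n \<bullet> Y = k}"
    unfolding infdist_notempty[OF ne]
  proof (rule cINF_greatest[OF ne])
    fix Y assume "Y \<in> {Y. n \<bullet> Y = k}"
    then have "\<bar>n \<bullet> X - k\<bar> = \<bar>n \<bullet> (X - Y)\<bar>" by (simp add: inner_diff_right)
    also have "\<dots> \<le> dist X Y"
      using Cauchy_Schwarz_ineq2[of n "X - Y"] by (simp add: assms dist_norm)
    finally show "\<bar>n \<bullet> X - k\<bar> \<le> dist X Y" .
  qed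
qed

text \<open>
  The hypothesis \<open>grad\<close> holds for \<open>u\<close> proportional to the gradient at \<open>A\<close> of a smooth function
  that vanishes on \<open>S\<close>.
\<close>

lemma tangent_line_normal_parallel:
  assumes tl: "tangent_line_at S A {X. w \<bullet> X = b}" and w: "norm w = 1"
    and grad: "\<And>X. X \<in> S \<Longrightarrow> \<bar>u \<bullet> (X - A)\<bar> \<le> (norm (X - A))\<^sup>2"
  shows "cross2 u w = 0"
proof -
  let ?q = "\<lambda>X. infdist X {X. w \<bullet> X = b} / dist X A"
  have b: "w \<bullet> A = b" and q: "(?q \<longlongrightarrow> 0) (at A within S)"
    and nt: "at A within S \<noteq> bot"
    using tl by (auto simp: tangent_line_at_def trivial_limit_within)
  \<comment> \<open>This function is the bound for \<open>\<bar>cross2 u w\<bar>\<close> after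
    division by \<open>norm (X - A)\<close>: the first term comes from \<open>grad\<close>, the
    second from the definition of the tangent line.\<close>
  have "((\<lambda>X. dist X A + ?q X * norm u) \<longlongrightarrow> dist A A + 0 * norm u) (at A within S)"
    by (intro tendsto_intros q)
  then have lim: "((\<lambda>X. dist X A + ?q X * norm u) \<longlongrightarrow> 0) (at A within S)"
    by simp
  have "eventually (\<lambda>X. \<bar>cross2 u w\<bar> \<le> dist X A + ?q X * norm u) (at A within S)"
    unfolding eventually_at_filter
  proof (intro always_eventually allI impI)
    fix X assume "X \<noteq> A" "X \<in> S"
    then have pos: "norm (X - A) > 0" by simp
    have "infdist X {X. w \<bullet> X = b} = \<bar>w \<bullet> (X - A)\<bar>"
      by (simp add: infdist_hyperplane w inner_diff_right b)
    moreover have "\<bar>cross2 u w\<bar> * norm (X - A)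
        \<le> (norm (X - A))\<^sup>2 + \<bar>w \<bullet> (X - A)\<bar> * norm u"
      using abs_cross2_mult_norm_le[of u w "X - A"] grad[OF \<open>X \<in> S\<close>] w by simp
    ultimately show "\<bar>cross2 u w\<bar> \<le> dist X A + ?q X * norm u"
      using pos by (simp add: dist_norm field_simps power2_eq_square)
  qed
  then have "\<bar>cross2 u w\<bar> \<le> 0"
    using tendsto_lowerbound[OF lim _ nt] by blast
  then show ?thesis by simp
qed

text \<open>The two arguments of \<open>cross2\<close> are half the gradients at \<open>A\<close> of
  the defining functions of the parabola and of the circle.\<close>

lemma parabola_circle_gradients_parallel:
  assumes K: "K = {X. (norm (X - F))\<^sup>2 = (n \<bullet> X - k)\<^sup>2}" and n: "norm n = 1"
    and tan: "curves_tangent_at K (sphere c r) A"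
  shows "cross2 (A - F - (n \<bullet> A - k) *\<^sub>R n) (A - c) = 0"
proof -
  obtain L where L: "tangent_line_at K A L" "tangent_line_at (sphere c r) A L"
    using tan by (auto simp: curves_tangent_at_def)
  then obtain w b where w: "norm w = 1" and Lw: "L = {X. w \<bullet> X = b}"
    by (metis is_line_unit_normal tangent_line_at_def)
  have AK: "A \<in> K" and AS: "A \<in> sphere c r"
    using L by (auto simp: tangent_line_at_def)
  have "cross2 (A - F - (n \<bullet> A - k) *\<^sub>R n) w = 0"
  proof (rule tangent_line_normal_parallel)
    fix X assume "X \<in> K"
    let ?z = "X - A"
    \<comment> \<open>Both sides of the equation of \<open>K\<close> are quadratic, so their
      expansions about \<open>A\<close> are exact. As \<open>X\<close> and \<open>A\<close> lie on
      \<open>K\<close>, twice the inner product to be bounded equals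
      \<open>(n \<bullet> ?z)\<^sup>2 - (norm ?z)\<^sup>2\<close>.\<close>
    have "(norm (X - F))\<^sup>2 = (norm (A - F))\<^sup>2 + 2 * ((A - F) \<bullet> ?z) + (norm ?z)\<^sup>2"
      by (simp add: power2_norm_eq_inner inner_diff_left inner_diff_right inner_commute)
    moreover have "(n \<bullet> X - k)\<^sup>2
        = (n \<bullet> A - k)\<^sup>2 + 2 * ((n \<bullet> A - k) * (n \<bullet> ?z)) + (n \<bullet> ?z)\<^sup>2"
      by (simp add: inner_diff_right power2_eq_square algebra_simps)
    moreover have "(A - F - (n \<bullet> A - k) *\<^sub>R n) \<bullet> ?z
        = (A - F) \<bullet> ?z - (n \<bullet> A - k) * (n \<bullet> ?z)"
      by (simp only: inner_diff_left[of "A - F"] inner_scaleR_left)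
    moreover have "(n \<bullet> ?z)\<^sup>2 \<le> (norm ?z)\<^sup>2"
      using norm_sq_rot90_coords[OF n, of ?z] by simp
    ultimately show "\<bar>(A - F - (n \<bullet> A - k) *\<^sub>R n) \<bullet> ?z\<bar> \<le> (norm ?z)\<^sup>2"
      using AK \<open>X \<in> K\<close> zero_le_power2[of "n \<bullet> ?z"] unfolding K mem_Collect_eq abs_le_iff
      by linarith
  qed (use L w Lw in auto)
  moreover have "cross2 (A - c) w = 0"
  proof (rule tangent_line_normal_parallel)
    fix X assume "X \<in> sphere c r"
    let ?z = "X - A"
    have "(norm (X - c))\<^sup>2 = (norm (A - c))\<^sup>2 + 2 * ((A - c) \<bullet> ?z) + (norm ?z)\<^sup>2"
      by (simp add: power2_norm_eq_inner inner_diff_left inner_diff_right inner_commute)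
    moreover have "norm (X - c) = norm (A - c)"
      using AS \<open>X \<in> sphere c r\<close> by (simp add: dist_norm norm_minus_commute)
    ultimately show "\<bar>(A - c) \<bullet> ?z\<bar> \<le> (norm ?z)\<^sup>2"
      using zero_le_power2[of "norm ?z"] unfolding abs_le_iff by (smt (verit))
  qed (use L w Lw in auto)
  moreover have "w \<noteq> 0" using w by auto
  ultimately show ?thesis by (rule cross2_zero_trans)
qed

text \<open>
  The points are \<open>A = (a1, a2)\<close>, \<open>B = (b1, b2)\<close> and the centre \<open>(c1, c2)\<close>.
\<close>

lemma bitangent_circle_coords:
  fixes a1 a2 b1 b2 c1 c2 h r :: real
  assumes h: "h \<noteq> 0" and ne: "a1 \<noteq> b1 \<or> a2 \<noteq> b2"
    and pa: "a1\<^sup>2 = 2 * h * a2 - h\<^sup>2" and pb: "b1\<^sup>2 = 2 * h * b2 - h\<^sup>2"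
    and ga: "a1 * (a2 - c2) + h * (a1 - c1) = 0"
    and gb: "b1 * (b2 - c2) + h * (b1 - c1) = 0"
    and ra: "(a1 - c1)\<^sup>2 + (a2 - c2)\<^sup>2 = r\<^sup>2" and rb: "(b1 - c1)\<^sup>2 + (b2 - c2)\<^sup>2 = r\<^sup>2"
  shows "a1 \<noteq> b1" "b2 = a2"
    and "(x - c1)\<^sup>2 + (y - c2)\<^sup>2 - r\<^sup>2 - (y - a2)\<^sup>2 = x\<^sup>2 - 2 * h * y + h\<^sup>2"
proof -
  show ab: "a1 \<noteq> b1"
  proof
    assume "a1 = b1"
    then have "2 * h * a2 = 2 * h * b2" using pa pb by (metis diff_add_cancel)
    with h ne \<open>a1 = b1\<close> show False by auto
  qed
  have d: "2 * h * (a2 - b2) = (a1 - b1) * (a1 + b1)"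
    using pa pb by algebra
  \<comment> \<open>The difference of \<open>ra\<close> and \<open>rb\<close>, multiplied by
    \<open>2 * h\<close> so that \<open>d\<close> allows the factor \<open>a1 - b1\<close> to be
    split off.\<close>
  have "2 * h * ((a1 - b1) * (a1 + b1 - 2 * c1) + (a2 - b2) * (a2 + b2 - 2 * c2)) = 0"
    using ra rb by algebra
  then have "(a1 - b1) * (2 * h * (a1 + b1 - 2 * c1) + (a1 + b1) * (a2 + b2 - 2 * c2)) = 0"
    using d by algebra
  then have "2 * h * (a1 + b1 - 2 * c1) + (a1 + b1) * (a2 + b2 - 2 * c2) = 0"
    using ab by simp
  \<comment> \<open>The product is twice the sum of the left sides of \<open>ga\<close> and
    \<open>gb\<close> minus the left side of the preceding equation.\<close>
  then have "(a1 - b1) * (a2 - b2) = 0"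
    using ga gb by algebra
  then show b2: "b2 = a2" using ab by simp
  then have "(a1 - b1) * (a1 + b1) = 0" using d by simp
  then have b1: "b1 = - a1" using ab by auto
  have "a1 \<noteq> 0" using ab b1 by auto
  have "h * c1 = 0" using ga gb unfolding b1 b2 by algebra
  then have c1: "c1 = 0" using h by simp
  have "a1 * (a2 - c2 + h) = 0" using ga unfolding c1 by algebra
  \<comment> \<open>The subnormal of a parabola has constant length, here \<open>h\<close> with its
    sign.\<close>
  then have c2: "c2 = a2 + h" using \<open>a1 \<noteq> 0\<close> by simp
  show "(x - c1)\<^sup>2 + (y - c2)\<^sup>2 - r\<^sup>2 - (y - a2)\<^sup>2 = x\<^sup>2 - 2 * h * y + h\<^sup>2"
    using ra pa unfolding c1 c2 by algebra
qed

lemma affine_hull_2_eq_line: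
  assumes n: "norm n = 1" and A: "n \<bullet> A = b" and B: "n \<bullet> B = b"
    and ne: "rot90 n \<bullet> A \<noteq> rot90 n \<bullet> B"
  shows "affine hull {A, B} = {X. n \<bullet> X = b}"
proof
  show "affine hull {A, B} \<subseteq> {X. n \<bullet> X = b}"
    by (rule hull_minimal) (auto simp: A B affine_hyperplane)
  show "{X. n \<bullet> X = b} \<subseteq> affine hull {A, B}"
  proof
    fix X assume "X \<in> {X. n \<bullet> X = b}"
    then have X: "n \<bullet> X = b" by simp
    \<comment> \<open>\<open>A\<close> and \<open>B\<close> differ in the coordinate along the line,
      so \<open>t\<close> can be chosen to make \<open>?Y\<close> agree with \<open>X\<close> there;
      the coordinate along \<open>n\<close> agrees for every \<open>t\<close>.\<close>
    define t where "t = (rot90 n \<bullet> X - rot90 n \<bullet> A) / (rot90 n \<bullet> B - rot90 n \<bullet> A)"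
    let ?Y = "(1 - t) *\<^sub>R A + t *\<^sub>R B"
    have "n \<bullet> (X - ?Y) = 0"
      by (simp add: inner_diff_right inner_add_right A B X algebra_simps)
    moreover have "t * (rot90 n \<bullet> B - rot90 n \<bullet> A) = rot90 n \<bullet> X - rot90 n \<bullet> A"
      using ne by (simp add: t_def)
    then have "rot90 n \<bullet> (X - ?Y) = 0"
      by (simp add: inner_diff_right inner_add_right algebra_simps)
    ultimately have "X = ?Y"
      using norm_sq_rot90_coords[OF n, of "X - ?Y"] by simp
    then show "X \<in> affine hull {A, B}"
      unfolding affine_hull_2 mem_Collect_eq by (metis diff_add_cancel)
  qed
qed

theorem lemma1:
  fixes K :: "(real^2) set" and c A B P :: "real^2" and r :: real
  assumes "is_parabola K"
    and "r > 0"
    and "A \<noteq> B"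
    and "curves_tangent_at K (sphere c r) A"
    and "curves_tangent_at K (sphere c r) B"
  shows "P \<in> K \<longleftrightarrow>
    r \<le> dist P c \<and> infdist P (affine hull {A, B}) = tangent_length c r P"
proof -
  obtain F d where d: "is_line d" "F \<notin> d" and K0: "K = {X. dist X F = infdist X d}"
    using assms(1) by (auto simp: is_parabola_def)
  obtain n k where n: "norm n = 1" and dn: "d = {X. n \<bullet> X = k}"
    using is_line_unit_normal[OF d(1)] .
  have K: "K = {X. (norm (X - F))\<^sup>2 = (n \<bullet> X - k)\<^sup>2}"
    unfolding K0 dn infdist_hyperplane[OF n] dist_norm
    by (rule Collect_cong) (smt (verit) norm_ge_zero power2_eq_iff)
  \<comment> \<open>The origin is the foot of the perpendicular from the focus to the directrix. The
    orientation of \<open>n\<close> is arbitrary, so \<open>h\<close> may be negative.\<close>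
  define h x y where "h = n \<bullet> F - k" and "x X = rot90 n \<bullet> (X - F)" and "y X = n \<bullet> X - k"
    for X
  have h: "h \<noteq> 0" using d(2) by (simp add: dn h_def)
  have xyF: "x F = 0" "y F = h" by (simp_all add: x_def y_def h_def)
  have xd: "rot90 n \<bullet> (X - Y) = x X - x Y" for X Y by (simp add: x_def inner_diff_right)
  have yd: "n \<bullet> (X - Y) = y X - y Y" for X Y by (simp add: y_def inner_diff_right)
  have dist2: "(dist X Y)\<^sup>2 = (x X - x Y)\<^sup>2 + (y X - y Y)\<^sup>2" for X Y
    using norm_sq_rot90_coords[OF n, of "X - Y"] by (simp add: dist_norm xd yd)
  have inK: "X \<in> K \<longleftrightarrow> (x X)\<^sup>2 = 2 * h * y X - h\<^sup>2" for X
    unfolding K mem_Collect_eq y_def[symmetric]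
    using dist2[of X F] by (auto simp: dist_norm xyF power2_eq_square algebra_simps)
  have tan: "(x T)\<^sup>2 = 2 * h * y T - h\<^sup>2"
      "x T * (y T - y c) + h * (x T - x c) = 0"
      "(x T - x c)\<^sup>2 + (y T - y c)\<^sup>2 = r\<^sup>2"
    if T: "curves_tangent_at K (sphere c r) T" for T
  proof -
    have TK: "T \<in> K" and TS: "dist T c = r"
      using T by (auto simp: curves_tangent_at_def tangent_line_at_def dist_commute)
    show "(x T)\<^sup>2 = 2 * h * y T - h\<^sup>2" using TK inK by simp
    show "(x T - x c)\<^sup>2 + (y T - y c)\<^sup>2 = r\<^sup>2" using TS dist2[of T c] by simp
    \<comment> \<open>Half the gradient at \<open>T\<close>; it has coordinates \<open>x T\<close>
      and \<open>- h\<close>.\<close>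
    let ?u = "T - F - (n \<bullet> T - k) *\<^sub>R n"
    have "n \<bullet> ?u = - h"
      using n by (simp add: inner_diff_right norm_eq_1 h_def)
    moreover have "rot90 n \<bullet> ?u = x T"
      by (simp add: x_def inner_diff_right) (simp add: inner_real2)
    ultimately show "x T * (y T - y c) + h * (x T - x c) = 0"
      using parabola_circle_gradients_parallel[OF K n T]
      by (simp add: cross2_rot90_coords[OF n] xd yd)
  qed
  have ne: "x A \<noteq> x B \<or> y A \<noteq> y B"
    using dist2[of A B] assms(3) by auto
  note bt = bitangent_circle_coords[OF h ne tan(1)[OF assms(4)] tan(1)[OF assms(5)]
      tan(2)[OF assms(4)] tan(2)[OF assms(5)] tan(3)[OF assms(4)] tan(3)[OF assms(5)]]
  \<comment> \<open>\<open>A\<close> and \<open>B\<close> have equal heights and distinct abscissas,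
    so their line is parallel to the directrix.\<close>
  have "affine hull {A, B} = {X. n \<bullet> X = n \<bullet> A}"
    using affine_hull_2_eq_line[OF n refl] bt(1,2) by (auto simp: x_def y_def inner_diff_right)
  then have id: "infdist P (affine hull {A, B}) = \<bar>y P - y A\<bar>"
    by (simp add: infdist_hyperplane[OF n] y_def)
  have pow: "P \<in> K \<longleftrightarrow> (dist P c)\<^sup>2 - r\<^sup>2 = (y P - y A)\<^sup>2"
    using bt(3)[of "x P" "y P"] by (auto simp: inK dist2)
  \<comment> \<open>On the parabola the power of \<open>P\<close> is a square, so \<open>P\<close>
    is not inside the circle; conversely \<open>r \<le> dist P c\<close> makes the radicand
    nonnegative, so that the equation with the root can be squared.\<close>
  have "r \<le> dist P c \<longleftrightarrow> 0 \<le> (dist P c)\<^sup>2 - r\<^sup>2"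
    using assms(2) by (simp add: power2_le_iff_abs_le)
  moreover have "sqrt p = \<bar>s\<bar> \<longleftrightarrow> p = s\<^sup>2" if "0 \<le> p" for p s :: real
    using that by (metis real_sqrt_abs real_sqrt_eq_iff)
  ultimately show ?thesis
    unfolding id tangent_length_def pow by (metis zero_le_power2)
qed

end
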